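(* The number of parking completions of $\mathbf{t}=(t_1,\dots,t_m)$ in $[n]$ is \[ \big|\mathrm{PC}_n(\mathbf{t})\big|=\sum_{\boldsymbol\ell\in L_n(\mathbf{t})} \binom{n-m}{\boldsymbol\ell}\prod_{j=1}^{m+1}(\ell_j+1)^{(\ell_j-1)}, \] where \[L_n(\mathbf{t})= \left\{\boldsymbol\ell=(\ell_1,\dots,\ell_{m+1})\in\mathbb{N}^{m+1}\,\middle\vert \begin{array}{l} \ell_1+\cdots+\ell_j \geq t_j-j \text{ for all } j\in[m], \text{ and}\\ \ell_1+\cdots+\ell_{m+1}=n-m \end{array} \right\}.\]
   Context: Let $[n]=\{1,\dots,n\}$ and $\mathbb{N}=\{0,1,2,\dots\}$. A parking function of length $n$ is a sequence $\mathbf{c}=(c_1,\dots,c_n)\in[n]^n$ such that there is a permutation $\sigma$ of $[n]$ with $c_{\sigma(i)}\le i$ for all $i$. Let $\mathbf{t}=(t_1,\dots,t_m)$ be a strictly increasing list of elements of $[n]$ (the taken spots) and let $\mathbf{u}=(u_1,\dots,u_{n-m})$ be the elements of $[n]\setminus\{t_1,\dots,t_m\}$ in increasing order. An increasing parking completion of $\mathbf{t}$ is a weakly increasing sequence $(c_1,\dots,c_{n-m})\in[n]^{n-m}$ with $c_i\le u_i$ for all $i$ (equivalently, $(t_1,\dots,t_m,c_1,\dots,c_{n-m})$ is a parking function). A parking completion of $\mathbf{t}$ in $[n]$ is a sequence in $[n]^{n-m}$ whose weakly increasing rearrangement is an increasing parking completion; $\mathrm{PC}_n(\mathbf{t})$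 denotes the set of parking completions of $\mathbf{t}$ in $[n]$. Here $\binom{n-m}{\boldsymbol\ell}=\frac{(n-m)!}{\ell_1!\cdots\ell_{m+1}!}$ is the multinomial coefficient. *)

theory Defs
  imports Complex_Main
begin

definition taken_spots :: "nat \<Rightarrow> nat list \<Rightarrow> bool" where
  "taken_spots n t \<longleftrightarrow> sorted_wrt (<) t \<and> set t \<subseteq> {1..n}"

definition free_spots :: "nat \<Rightarrow> nat list \<Rightarrow> nat list" where
  "free_spots n t = sorted_list_of_set ({1..n} - set t)"

definition increasing_parking_completion :: "nat \<Rightarrow> nat list \<Rightarrow> nat list \<Rightarrow> bool" where
  "increasing_parking_completion n t c \<longleftrightarrow>
     length c = n - length t \<and> set c \<subseteq> {1..n} \<and> sorted c \<and>
     (\<forall>i < n - length t. c ! i \<le> free_spots n t ! i)"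

definition parking_completions :: "nat \<Rightarrow> nat list \<Rightarrow> nat list set" where
  "parking_completions n t =
     {c. length c = n - length t \<and> set c \<subseteq> {1..n} \<and>
         increasing_parking_completion n t (sort c)}"

text \<open>
  Lists are indexed from 0, so the \<open>j\<close>-th entry of a sequence numbered from 1 is
  \<open>t ! (j - 1)\<close>, and the sum of the first \<open>j\<close> entries is \<open>sum_list (take j l)\<close>.
\<close>

definition L :: "nat \<Rightarrow> nat list \<Rightarrow> nat list set" where
  "L n t =
     {l. length l = length t + 1 \<and>
         (\<forall>j \<in> {1..length t}. int (sum_list (take j l)) \<ge> int (t ! (j - 1)) - int j) \<and>
         sum_list l = n - length t}"

definition multinomial :: "nat \<Rightarrow> nat list \<Rightarrow> real" where
  "multinomial N l = fact N / (\<Prod>k\<leftarrow>l. fact k)"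

end

(*
  Let the cars of a completion c park on the empty street 1..n. They leave m spots
  e_1 < ... < e_m empty, and c is a completion of t iff e_j >= t_j for all j. If l_j cars park
  between e_(j-1) and e_j, then e_j = l_1 + ... + l_j + j, so these inequalities say that l lies
  in L_n(t), and each block of cars is a parking function, of which there are (l_j+1)^(l_j-1).
  The argument runs by induction on m, splitting at the last empty spot e_m. Parking itself
  never occurs: a preference list is handled through its tail counts #{i. c_i >= s}.
*)

theory Submission
  imports Defs "HOL-Library.FuncSet"
begin

section \<open>Preferences described by tail counts\<close>

text \<open>The cars preferring \<open>s\<close> or later, together with the taken spots from
  \<open>s\<close> on, must fit into the \<open>n + 1 - s\<close> spots of \<open>{s..n}\<close>.
  Cars form an arbitrary set \<open>A\<close> of unprescribed size, because the recursions pass to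
  subsets of the cars and to shorter streets.\<close>

definition tail_bounded :: "'a set \<Rightarrow> nat \<Rightarrow> nat list \<Rightarrow> ('a \<Rightarrow> nat) set" where
  "tail_bounded A n t =
     {c \<in> A \<rightarrow>\<^sub>E {1..n}. \<forall>s \<in> {1..n}.
        card {i \<in> A. s \<le> c i} + length (filter (\<lambda>x. s \<le> x) t) \<le> n + 1 - s}"

lemma finite_tail_bounded: "finite A \<Longrightarrow> finite (tail_bounded A n t)"
  by (rule finite_subset[of _ "A \<rightarrow>\<^sub>E {1..n}"]) (auto simp: tail_bounded_def intro: finite_PiE)

text \<open>Used with two cutoffs: \<open>K = card A\<close> for all subsets, and
  \<open>K = n - x\<close> for the possible blocks behind the last empty spot.\<close>

lemma sum_subsets_by_card:
  fixes h :: "nat \<Rightarrow> 'b::comm_semiring_1"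
  assumes "finite A"
  shows "(\<Sum>B | B \<subseteq> A \<and> card B \<le> K. h (card B)) = (\<Sum>k\<le>K. of_nat (card A choose k) * h k)"
proof -
  let ?S = "{B. B \<subseteq> A \<and> card B \<le> K}"
  have "(\<Sum>B\<in>?S. h (card B)) = (\<Sum>k\<le>K. \<Sum>B | B \<in> ?S \<and> card B = k. h (card B))"
    by (rule sum.group[symmetric]) (use assms in auto)
  also have "\<dots> = (\<Sum>k\<le>K. of_nat (card A choose k) * h k)"
  proof (rule sum.cong[OF refl])
    fix k assume "k \<in> {..K}"
    then have "{B. B \<in> ?S \<and> card B = k} = {B. B \<subseteq> A \<and> card B = k}" by auto
    then show "(\<Sum>B | B \<in> ?S \<and> card B = k. h (card B)) = of_nat (card A choose k) * h k"
      by (simp add: n_subsets[OF assms])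
  qed
  finally show ?thesis .
qed

text \<open>Absorption, \<open>k * (N choose k) = N * (N - 1 choose k - 1)\<close> with
  \<open>N = Suc M\<close>, followed by the binomial theorem.\<close>

lemma sum_index_binomial:
  fixes x :: "'a::comm_semiring_1"
  shows "(\<Sum>k\<le>Suc M. of_nat (Suc M choose k) * (of_nat k * x ^ k)) = of_nat (Suc M) * x * (x + 1) ^ M"
proof -
  have "(\<Sum>k\<le>Suc M. of_nat (Suc M choose k) * (of_nat k * x ^ k))
      = (\<Sum>k\<le>M. of_nat (Suc k * (Suc M choose Suc k)) * x ^ Suc k)"
    by (subst sum.atMost_Suc_shift) (simp add: mult_ac del: binomial_Suc_Suc of_nat_Suc mult_Suc)
  also have "\<dots> = (\<Sum>k\<le>M. of_nat (Suc M) * x * (of_nat (M choose k) * x ^ k))"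
    by (simp only: Suc_times_binomial of_nat_mult power_Suc mult_ac)
  also have "\<dots> = of_nat (Suc M) * x * (\<Sum>k\<le>M. of_nat (M choose k) * x ^ k * 1 ^ (M - k))"
    by (simp only: sum_distrib_left[symmetric] power_one mult_1_right)
  also have "\<dots> = of_nat (Suc M) * x * (x + 1) ^ M"
    by (simp only: binomial_ring)
  finally show ?thesis .
qed

section \<open>Counting parking functions\<close>

text \<open>Delete spot 1 and the cars preferring it, and shift the remaining cars \<open>B\<close>
  down by one. The bound at \<open>s \<ge> 2\<close> becomes the bound at \<open>s - 1\<close> for
  \<open>B\<close>, while the bound at \<open>s = 1\<close> only says
  \<open>card A \<le> Suc n\<close>.\<close>

lemma bij_betw_tail_bounded_Suc:
  assumes "finite A" "card A \<le> Suc n" "B \<subseteq> A"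
  shows "bij_betw (\<lambda>f. \<lambda>i\<in>A. if i \<in> B then Suc (f i) else 1)
           (tail_bounded B n []) {c \<in> tail_bounded A (Suc n) []. {i \<in> A. 2 \<le> c i} = B}"
proof (rule bij_betw_byWitness[where f' = "\<lambda>c. \<lambda>i\<in>B. c i - 1"])
  let ?F = "\<lambda>f. \<lambda>i\<in>A. if i \<in> B then Suc (f i) else 1"
  show "\<forall>f\<in>tail_bounded B n []. (\<lambda>i\<in>B. ?F f i - 1) = f"
    using assms(3) by (fastforce simp: tail_bounded_def intro!: PiE_ext[of _ B "\<lambda>_. {1..n}"])
  show "\<forall>c\<in>{c \<in> tail_bounded A (Suc n) []. {i \<in> A. 2 \<le> c i} = B}. ?F (\<lambda>i\<in>B. c i - 1) = c"
  proof
    fix c assume c: "c \<in> {c \<in> tail_bounded A (Suc n) []. {i \<in> A. 2 \<le> c i} = B}"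
    then have cA: "c \<in> A \<rightarrow>\<^sub>E {1..Suc n}" and B: "B = {i \<in> A. 2 \<le> c i}"
      by (auto simp: tail_bounded_def)
    show "?F (\<lambda>i\<in>B. c i - 1) = c"
    proof
      \<comment> \<open>Off \<open>A\<close> both sides are \<open>undefined\<close>; in
        \<open>A\<close> but not in \<open>B\<close> the preference lies below 2, so it is
        1.\<close>
      fix i show "?F (\<lambda>i\<in>B. c i - 1) i = c i"
        using PiE_mem[OF cA, of i] PiE_arb[OF cA, of i] B by auto
    qed
  qed
  show "?F ` tail_bounded B n [] \<subseteq> {c \<in> tail_bounded A (Suc n) []. {i \<in> A. 2 \<le> c i} = B}"
  proof (rule image_subsetI)
    fix f assume f: "f \<in> tail_bounded B n []"
    then have fB: "f \<in> B \<rightarrow>\<^sub>E {1..n}"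
      and ft: "\<And>s. 1 \<le> s \<Longrightarrow> s \<le> n \<Longrightarrow> card {i \<in> B. s \<le> f i} \<le> n + 1 - s"
      by (auto simp: tail_bounded_def)
    have f1: "1 \<le> f i" "f i \<le> n" if "i \<in> B" for i using PiE_mem[OF fB that] by auto
    have "card {i \<in> A. s \<le> ?F f i} \<le> Suc n + 1 - s" if s: "s \<in> {1..Suc n}" for s
    proof (cases "s = 1")
      case True
      have "card {i \<in> A. s \<le> ?F f i} \<le> card A"
        using assms(1) by (intro card_mono) auto
      then show ?thesis using assms(2) True by simp
    next
      case False
      then have "{i \<in> A. s \<le> ?F f i} = {i \<in> B. s - 1 \<le> f i}"
        using s assms(3) by (auto split: if_splits)
      then show ?thesis using ft[of "s - 1"] s False by auto
    qed
    moreover have "{i \<in> A. 2 \<le> ?F f i} = B"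
      using assms(3) f1 by (auto split: if_splits)
    moreover have "?F f \<in> A \<rightarrow>\<^sub>E {1..Suc n}"
      using f1 by auto
    ultimately show "?F f \<in> {c \<in> tail_bounded A (Suc n) []. {i \<in> A. 2 \<le> c i} = B}"
      unfolding tail_bounded_def by simp
  qed
  show "(\<lambda>c. \<lambda>i\<in>B. c i - 1) ` {c \<in> tail_bounded A (Suc n) []. {i \<in> A. 2 \<le> c i} = B}
      \<subseteq> tail_bounded B n []"
  proof (rule image_subsetI)
    fix c assume c: "c \<in> {c \<in> tail_bounded A (Suc n) []. {i \<in> A. 2 \<le> c i} = B}"
    then have cA: "c \<in> A \<rightarrow>\<^sub>E {1..Suc n}" and B: "B = {i \<in> A. 2 \<le> c i}"
      and ct: "\<And>s. 1 \<le> s \<Longrightarrow> s \<le> Suc n \<Longrightarrow> card {i \<in> A. s \<le> c i} \<le> Suc n + 1 - s"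
      by (auto simp: tail_bounded_def)
    have "{i \<in> B. s \<le> (\<lambda>i\<in>B. c i - 1) i} = {i \<in> A. Suc s \<le> c i}" if "1 \<le> s" for s
      using that B by auto
    moreover have "(\<lambda>i\<in>B. c i - 1) \<in> B \<rightarrow>\<^sub>E {1..n}"
      using PiE_mem[OF cA] B by fastforce
    ultimately show "(\<lambda>i\<in>B. c i - 1) \<in> tail_bounded B n []"
      using ct unfolding tail_bounded_def by fastforce
  qed
qed

text \<open>For \<open>a\<close> cars on \<open>n\<close> spots this is
  \<open>(n+1-a) (n+1)^(a-1)\<close>, written as a quotient so that \<open>a = 0\<close> is covered.
  The recursion sums over the set \<open>B\<close> of cars not preferring spot 1. Since
  \<open>B\<close> may have one car more than the shorter street has spots, the claim extends to
  \<open>a = n + 1\<close>, where both sides are 0.\<close>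

lemma card_tail_bounded_Nil:
  assumes "finite A" "card A \<le> n + 1"
  shows "real (card (tail_bounded A n [])) = (real n + 1 - real (card A)) * (real n + 1) ^ card A / (real n + 1)"
  using assms
proof (induction n arbitrary: A)
  case 0
  show ?case
  proof (cases "A = {}")
    case True then show ?thesis by (simp add: tail_bounded_def)
  next
    case False
    then have "card A = 1" using 0 by (metis One_nat_def add_0 card_gt_0_iff le_antisym Suc_leI)
    moreover have "A \<rightarrow>\<^sub>E {1..0::nat} = {}" using False by (auto simp: PiE_eq_empty_iff)
    ultimately show ?thesis by (simp add: tail_bounded_def)
  qed
next
  case (Suc n)
  let ?N = "card A" and ?x = "real n + 1"
  show ?case
  proof (cases "card A = n + 2")
    \<comment> \<open>One car too many: the bound at \<open>s = 1\<close> fails for every function,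
      and the first factor of the formula vanishes.\<close>
    case True
    have "c \<notin> tail_bounded A (Suc n) []" for c
    proof
      assume "c \<in> tail_bounded A (Suc n) []"
      then have "c \<in> A \<rightarrow>\<^sub>E {1..Suc n}" and "card {i \<in> A. 1 \<le> c i} \<le> Suc n"
        by (auto simp: tail_bounded_def dest!: bspec[where x = 1])
      moreover from this(1) have "{i \<in> A. 1 \<le> c i} = A" using PiE_mem by fastforce
      ultimately show False using True by simp
    qed
    then have "tail_bounded A (Suc n) [] = {}" by blast
    then show ?thesis using True by simp
  next
    case False
    then have N: "?N \<le> Suc n" using Suc.prems by simp
    have "card (tail_bounded A (Suc n) []) =
        (\<Sum>B\<in>Pow A. card {c \<in> tail_bounded A (Suc n) []. {i \<in> A. 2 \<le> c i} = B})"
      unfolding card_eq_sum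
      by (rule sum.group[symmetric]) (use Suc.prems(1) finite_tail_bounded in auto)
    also have "\<dots> = (\<Sum>B\<in>Pow A. card (tail_bounded B n []))"
      using bij_betw_same_card[OF bij_betw_tail_bounded_Suc[OF Suc.prems(1) N]]
      by (intro sum.cong) auto
    finally have "real (card (tail_bounded A (Suc n) [])) = (\<Sum>B\<in>Pow A. real (card (tail_bounded B n [])))"
      by simp
    also have "\<dots> = (\<Sum>B\<in>Pow A. (?x - real (card B)) * ?x ^ card B / ?x)"
    proof (rule sum.cong[OF refl])
      fix B assume "B \<in> Pow A"
      then have "finite B" "card B \<le> n + 1"
        using Suc.prems(1) N finite_subset card_mono[of A B] by auto
      then show "real (card (tail_bounded B n [])) = (?x - real (card B)) * ?x ^ card B / ?x"
        by (rule Suc.IH)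
    qed
    also have "Pow A = {B. B \<subseteq> A \<and> card B \<le> card A}"
      using Suc.prems(1) by (auto simp: card_mono)
    also have "(\<Sum>B | B \<subseteq> A \<and> card B \<le> card A. (?x - real (card B)) * ?x ^ card B / ?x)
       = (\<Sum>k\<le>?N. of_nat (?N choose k) * ((?x - real k) * ?x ^ k / ?x))"
      by (rule sum_subsets_by_card[OF Suc.prems(1), where h = "\<lambda>k. (?x - real k) * ?x ^ k / ?x"])
    \<comment> \<open>Splitting \<open>?x - real k\<close> separates a plain binomial sum from one
      weighted by \<open>k\<close>; the trivial powers of 1 match the shape of
      \<open>binomial_ring\<close>.\<close>
    also have "\<dots> = (\<Sum>k\<le>?N. of_nat (?N choose k) * ?x ^ k * 1 ^ (?N - k))
       - (\<Sum>k\<le>?N. of_nat (?N choose k) * (of_nat k * ?x ^ k)) / ?x"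
      by (simp add: sum_divide_distrib sum_subtractf[symmetric] field_simps)
    also have "\<dots> = (?x + 1) ^ ?N - real ?N * (?x + 1) ^ ?N / (?x + 1)"
    proof (cases ?N)
      case 0 then show ?thesis by simp
    next
      case (Suc M)
      show ?thesis
        unfolding Suc sum_index_binomial binomial_ring[symmetric]
        by (simp add: field_simps add_pos_nonneg)
    qed
    also have "\<dots> = (real (Suc n) + 1 - real ?N) * (real (Suc n) + 1) ^ ?N / (real (Suc n) + 1)"
      by (simp add: field_simps)
    finally show ?thesis .
  qed
qed

text \<open>With as many cars as spots the linear factor is 1. The integer power admits
  \<open>n = 0\<close>, where the exponent is -1 and the base is 1.\<close>

lemma card_parking_functions:
  assumes "finite A" "card A = n"
  shows "real (card (tail_bounded A n [])) = (real n + 1) powi (int n - 1)"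
  using assms card_tail_bounded_Nil[of A n] by (simp add: power_int_diff)

section \<open>Splitting at the last empty spot\<close>

lemma taken_spots_length: "taken_spots n t \<Longrightarrow> length t \<le> n"
  unfolding taken_spots_def
  by (metis card_atLeastAtMost card_mono diff_Suc_1 distinct_card finite_atLeastAtMost
      strict_sorted_iff)

text \<open>For the induction that removes the largest taken spot: the street before the last empty
  spot reaches at least to \<open>x - 1\<close>, and \<open>taken_spots_mono\<close> then carries
  \<open>t\<close> over.\<close>

lemma taken_spots_snoc:
  "taken_spots n (t @ [x]) \<longleftrightarrow> 1 \<le> x \<and> x \<le> n \<and> taken_spots (x - 1) t"
  unfolding taken_spots_def by (fastforce simp: sorted_wrt_append)

lemma taken_spots_mono: "taken_spots n t \<Longrightarrow> n \<le> n' \<Longrightarrow> taken_spots n' t"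
  unfolding taken_spots_def by auto

text \<open>
  In \<open>last_empty A n t e S\<close> the spot \<open>e\<close> is the last one left empty when the cars
  \<open>A\<close> park on the empty street, and \<open>S\<close> is the set of cars parked behind it.
\<close>

definition last_empty :: "'a set \<Rightarrow> nat \<Rightarrow> nat list \<Rightarrow> nat \<Rightarrow> 'a set \<Rightarrow> ('a \<Rightarrow> nat) set" where
  "last_empty A n t e S =
     {c \<in> tail_bounded A n t. {i \<in> A. e < c i} = S \<and>
        (\<forall>s \<in> {1..e}. card {i \<in> A. s \<le> c i} \<le> n - s)}"

text \<open>The cars of \<open>S\<close> fill all spots behind \<open>e\<close>, so shifted down by
  \<open>e\<close> they form a parking function. For \<open>s \<le> e\<close> every car of
  \<open>S\<close> counts in the tail, and subtracting \<open>card S = n - e\<close> from the bounds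
  leaves those of a completion of \<open>t\<close> in the spots before \<open>e\<close>. The empty
  spot \<open>e\<close> absorbs the taken spot \<open>x\<close>.\<close>

lemma bij_betw_last_empty:
  assumes "finite A" and t: "taken_spots n (t @ [x])"
    and S: "S \<subseteq> A" and e: "card S + e = n" and x: "x \<le> e"
  shows "bij_betw (\<lambda>(f, g). \<lambda>i\<in>A. if i \<in> S then f i + e else g i)
           (tail_bounded S (card S) [] \<times> tail_bounded (A - S) (e - 1) t)
           (last_empty A n (t @ [x]) e S)"
proof (rule bij_betw_byWitness[where f' = "\<lambda>c. (\<lambda>i\<in>S. c i - e, restrict c (A - S))"])
  let ?F = "\<lambda>(f, g). \<lambda>i\<in>A. if i \<in> S then f i + e else g i"
  let ?D = "tail_bounded S (card S) [] \<times> tail_bounded (A - S) (e - 1) t"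
  let ?G = "\<lambda>c. (\<lambda>i\<in>S. c i - e, restrict c (A - S))"
  have finS: "finite S" using assms(1) S finite_subset by blast
  have tx: "\<And>y. y \<in> set t \<Longrightarrow> y < x" and x1: "1 \<le> x"
    using t by (auto simp: taken_spots_def sorted_wrt_append)
  have filter_above: "filter (\<lambda>y. s \<le> y) t = []" if "x \<le> s" for s
    using tx that by (fastforce simp: filter_empty_conv)
  have card_split: "card {i \<in> A. s \<le> c i} = card S + card {i \<in> A - S. s \<le> c i}"
    if "\<And>i. i \<in> S \<Longrightarrow> s \<le> c i" for s and c :: "'a \<Rightarrow> nat"
  proof -
    have "{i \<in> A. s \<le> c i} = S \<union> {i \<in> A - S. s \<le> c i}" using that S by auto
    then show ?thesis using assms(1) finS by (simp add: card_Un_disjoint disjoint_iff)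
  qed
  show "\<forall>p\<in>?D. ?G (?F p) = p"
  proof
    fix p assume "p \<in> ?D"
    then obtain f g where p: "p = (f, g)" and f: "f \<in> S \<rightarrow>\<^sub>E {1..card S}"
      and g: "g \<in> (A - S) \<rightarrow>\<^sub>E {1..e - 1}"
      by (auto simp: tail_bounded_def)
    have "(\<lambda>i\<in>S. ?F p i - e) i = f i" for i
      using p S PiE_arb[OF f, of i] by auto
    moreover have "restrict (?F p) (A - S) i = g i" for i
      using p PiE_arb[OF g, of i] by auto
    ultimately show "?G (?F p) = p" unfolding p by (simp add: fun_eq_iff)
  qed
  show "\<forall>c\<in>last_empty A n (t @ [x]) e S. ?F (?G c) = c"
  proof
    fix c assume "c \<in> last_empty A n (t @ [x]) e S"
    then have c: "c \<in> A \<rightarrow>\<^sub>E {1..n}" and "S = {i \<in> A. e < c i}"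
      by (auto simp: last_empty_def tail_bounded_def)
    then show "?F (?G c) = c"
      using PiE_arb[OF c] by (auto simp: fun_eq_iff)
  qed
  show "?F ` ?D \<subseteq> last_empty A n (t @ [x]) e S"
  proof (rule image_subsetI)
    fix p assume "p \<in> ?D"
    then obtain f g where p: "p = (f, g)" and f: "f \<in> S \<rightarrow>\<^sub>E {1..card S}"
      and g: "g \<in> (A - S) \<rightarrow>\<^sub>E {1..e - 1}"
      and ft: "\<And>s. 1 \<le> s \<Longrightarrow> s \<le> card S \<Longrightarrow> card {i \<in> S. s \<le> f i} \<le> card S + 1 - s"
      and gt: "\<And>s. 1 \<le> s \<Longrightarrow> s \<le> e - 1 \<Longrightarrow>
        card {i \<in> A - S. s \<le> g i} + length (filter (\<lambda>y. s \<le> y) t) \<le> e - 1 + 1 - s"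
      unfolding tail_bounded_def by fastforce
    define c where "c = ?F p"
    have cS: "c i = f i + e" if "i \<in> S" for i using that S p by (auto simp: c_def)
    have cg: "c i = g i" if "i \<in> A - S" for i using that p by (auto simp: c_def)
    have f1: "1 \<le> f i" "f i \<le> card S" if "i \<in> S" for i using PiE_mem[OF f that] by auto
    have g1: "1 \<le> g i" "g i < e" if "i \<in> A - S" for i
      using PiE_mem[OF g that] x x1 by auto
    have cPi: "c \<in> A \<rightarrow>\<^sub>E {1..n}"
    proof (rule PiE_I)
      fix i assume "i \<in> A"
      then show "c i \<in> {1..n}"
        using cS[of i] cg[of i] f1[of i] g1[of i] e by (cases "i \<in> S") auto
    next
      fix i assume "i \<notin> A"
      then show "c i = undefined" by (simp add: c_def p)
    qed
    have Seq: "{i \<in> A. e < c i} = S"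
    proof (intro equalityI subsetI)
      fix i assume i: "i \<in> {i \<in> A. e < c i}"
      then show "i \<in> S" using cg[of i] g1[of i] by (cases "i \<in> S") auto
    next
      fix i assume "i \<in> S"
      then show "i \<in> {i \<in> A. e < c i}" using cS f1[of i] S by auto
    qed
    \<comment> \<open>One sharper than the tail bound for \<open>t\<close>: the spare unit pays for
      \<open>x\<close>, and dropping the taken spots gives the extra condition in
      \<open>last_empty\<close>.\<close>
    have low: "card {i \<in> A. s \<le> c i} + length (filter (\<lambda>y. s \<le> y) t) \<le> n - s"
      if s: "1 \<le> s" "s \<le> e" for s
    proof -
      have split: "card {i \<in> A. s \<le> c i} = card S + card {i \<in> A - S. s \<le> c i}"
        by (rule card_split) (use cS s in auto)
      have gs: "{i \<in> A - S. s \<le> c i} = {i \<in> A - S. s \<le> g i}" using cg by auto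
      show ?thesis
      proof (cases "s = e")
        case True
        have no_car: "{i \<in> A - S. s \<le> c i} = {}" using g1 cg True by force
        show ?thesis using True split[unfolded no_car] filter_above[OF x] e by simp
      next
        case False
        then have "s \<le> e - 1" using s by auto
        from gt[OF s(1) this] show ?thesis using split gs e s by simp
      qed
    qed
    have "card {i \<in> A. s \<le> c i} + length (filter (\<lambda>y. s \<le> y) (t @ [x])) \<le> n + 1 - s"
      if s: "s \<in> {1..n}" for s
    proof (cases "s \<le> e")
      case True
      then show ?thesis using low[of s] s by auto
    next
      case False
      have "{i \<in> A. s \<le> c i} = {i \<in> S. s - e \<le> f i}"
      proof (intro equalityI subsetI)
        fix i assume i: "i \<in> {i \<in> A. s \<le> c i}"
        then have "i \<in> S" using Seq False by auto
        then show "i \<in> {i \<in> S. s - e \<le> f i}" using i cS[of i] by auto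
      next
        fix i assume "i \<in> {i \<in> S. s - e \<le> f i}"
        then show "i \<in> {i \<in> A. s \<le> c i}" using cS[of i] S by auto
      qed
      then show ?thesis using False ft[of "s - e"] filter_above[of s] x e s by auto
    qed
    moreover have "card {i \<in> A. s \<le> c i} \<le> n - s" if "s \<in> {1..e}" for s
      using low[of s] that by auto
    ultimately show "?F p \<in> last_empty A n (t @ [x]) e S"
      unfolding c_def[symmetric] last_empty_def tail_bounded_def using cPi Seq by auto
  qed
  show "?G ` last_empty A n (t @ [x]) e S \<subseteq> ?D"
  proof (rule image_subsetI)
    fix c assume "c \<in> last_empty A n (t @ [x]) e S"
    then have c: "c \<in> A \<rightarrow>\<^sub>E {1..n}" and Seq: "S = {i \<in> A. e < c i}"
      and ct: "\<And>s. 1 \<le> s \<Longrightarrow> s \<le> n \<Longrightarrow>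
        card {i \<in> A. s \<le> c i} + length (filter (\<lambda>y. s \<le> y) (t @ [x])) \<le> n + 1 - s"
      and ce: "\<And>s. 1 \<le> s \<Longrightarrow> s \<le> e \<Longrightarrow> card {i \<in> A. s \<le> c i} \<le> n - s"
      by (auto simp: last_empty_def tail_bounded_def)
    have c1: "1 \<le> c i" "c i \<le> n" if "i \<in> A" for i using PiE_mem[OF c that] by auto
    \<comment> \<open>At \<open>e\<close> the bound \<open>ce\<close> allows
      \<open>n - e = card S\<close> cars, and \<open>S\<close> already supplies that many.\<close>
    have ne: "c i \<noteq> e" if "i \<in> A - S" for i
    proof
      assume "c i = e"
      then have "card {i \<in> A - S. e \<le> c i} > 0"
        using that assms(1) by (auto simp: card_gt_0_iff)
      moreover have "card {i \<in> A. e \<le> c i} = card S + card {i \<in> A - S. e \<le> c i}"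
        by (rule card_split) (use Seq in auto)
      ultimately show False using ce[of e] x x1 e by auto
    qed
    have 1: "(\<lambda>i\<in>S. c i - e) \<in> tail_bounded S (card S) []"
    proof -
      have "(\<lambda>i\<in>S. c i - e) \<in> S \<rightarrow>\<^sub>E {1..card S}"
        using c1 Seq e by (fastforce simp: le_diff_conv)
      moreover have "card {i \<in> S. s \<le> (\<lambda>i\<in>S. c i - e) i} \<le> card S + 1 - s"
        if s: "s \<in> {1..card S}" for s
      proof -
        have "{i \<in> S. s \<le> (\<lambda>i\<in>S. c i - e) i} = {i \<in> A. s + e \<le> c i}"
          using s Seq by auto
        then show ?thesis using ct[of "s + e"] s e by auto
      qed
      ultimately show ?thesis unfolding tail_bounded_def by simp
    qed
    have 2: "restrict c (A - S) \<in> tail_bounded (A - S) (e - 1) t"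
    proof -
      have "restrict c (A - S) \<in> (A - S) \<rightarrow>\<^sub>E {1..e - 1}"
      proof (rule PiE_I)
        fix i assume "i \<in> A - S"
        then show "restrict c (A - S) i \<in> {1..e - 1}"
          using c1[of i] ne[of i] Seq by auto
      qed auto
      moreover have "card {i \<in> A - S. s \<le> restrict c (A - S) i} + length (filter (\<lambda>y. s \<le> y) t)
          \<le> e - 1 + 1 - s" if s: "s \<in> {1..e - 1}" for s
      proof -
        have eq: "{i \<in> A - S. s \<le> restrict c (A - S) i} = {i \<in> A - S. s \<le> c i}" by auto
        have split: "card {i \<in> A. s \<le> c i} = card S + card {i \<in> A - S. s \<le> c i}"
          by (rule card_split) (use Seq s in auto)
        \<comment> \<open>The bound must improve by one. For \<open>s \<le> x\<close> the taken spot
          \<open>x\<close> counts in \<open>ct\<close> and supplies the unit; beyond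
          \<open>x\<close> no spot of \<open>t\<close> is counted and \<open>ce\<close> is already
          sharp enough.\<close>
        show ?thesis
        proof (cases "s \<le> x")
          case True
          have "1 \<le> s" "s \<le> n" using s e by auto
          from ct[OF this] show ?thesis using True split eq s e by simp
        next
          case False
          have "1 \<le> s" "s \<le> e" using s by auto
          from ce[OF this] show ?thesis using False split eq s e filter_above[of s] by simp
        qed
      qed
      ultimately show ?thesis unfolding tail_bounded_def by simp
    qed
    show "?G c \<in> ?D" using 1 2 by simp
  qed
qed

text \<open>
  The spot behind the last empty one is the least \<open>s\<close> such that the cars preferring
  \<open>s\<close> or later fill all of \<open>{s..n}\<close>.
\<close>

lemma tail_bounded_last_empty:
  assumes t: "taken_spots n (t @ [x])" and c: "c \<in> tail_bounded A n (t @ [x])"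
  obtains S where "S \<subseteq> A" "card S \<le> n - x" "c \<in> last_empty A n (t @ [x]) (n - card S) S"
proof -
  have cPi: "c \<in> A \<rightarrow>\<^sub>E {1..n}"
    and ct: "\<And>s. 1 \<le> s \<Longrightarrow> s \<le> n \<Longrightarrow>
        card {i \<in> A. s \<le> c i} + length (filter (\<lambda>y. s \<le> y) (t @ [x])) \<le> n + 1 - s"
    using c by (auto simp: tail_bounded_def)
  have c1: "1 \<le> c i" "c i \<le> n" if "i \<in> A" for i using PiE_mem[OF cPi that] by auto
  have x1: "1 \<le> x" using t by (simp add: taken_spots_snoc)
  \<comment> \<open>The tail starts strictly after \<open>s\<close>, so that the least
    \<open>s\<close> is the empty spot itself and not the one behind it.\<close>
  define P where "P s \<longleftrightarrow> card {i \<in> A. s < c i} = n - s \<and> s \<le> n" for s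
  define e where "e = (LEAST s. P s)"
  have no_car: "{i \<in> A. n < c i} = {}" using c1 by force
  have "P n" by (simp add: P_def no_car)
  then have Pe: "P e" and least: "\<And>s. s < e \<Longrightarrow> \<not> P s"
    unfolding e_def by (auto intro: LeastI dest: not_less_Least)
  define S where "S = {i \<in> A. e < c i}"
  have cardS: "card S = n - e" and en: "e \<le> n" using Pe by (auto simp: P_def S_def)
  \<comment> \<open>If \<open>e < x\<close>, the bound at \<open>Suc e\<close> also counts the taken
    spot \<open>x\<close> and leaves room for at most \<open>n - e - 1\<close> cars, but
    \<open>S\<close> has \<open>n - e\<close>.\<close>
  have xe: "x \<le> e"
  proof (rule ccontr)
    assume "\<not> x \<le> e"
    then have "e < n" using t by (simp add: taken_spots_snoc)
    then have "card {i \<in> A. Suc e \<le> c i} + 1 \<le> n - e"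
      using ct[of "Suc e"] \<open>\<not> x \<le> e\<close> by auto
    then show False using cardS by (simp add: S_def Suc_le_eq)
  qed
  have "card {i \<in> A. s \<le> c i} \<le> n - s" if s: "s \<in> {1..e}" for s
  proof -
    have "card {i \<in> A. s \<le> c i} \<le> n + 1 - s" using ct[of s] s en by auto
    \<comment> \<open>Equality would make the tail from \<open>s\<close> on exactly full, so
      \<open>P (s - 1)\<close> would contradict the minimality of \<open>e\<close>.\<close>
    moreover have "card {i \<in> A. s \<le> c i} \<noteq> n + 1 - s"
    proof
      assume "card {i \<in> A. s \<le> c i} = n + 1 - s"
      moreover have "{i \<in> A. s \<le> c i} = {i \<in> A. s - 1 < c i}" using s by auto
      ultimately have "P (s - 1)" using s en by (auto simp: P_def)
      moreover have "s - 1 < e" using s by auto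
      ultimately show False using least by blast
    qed
    ultimately show ?thesis by linarith
  qed
  moreover have "n - card S = e" using cardS en by simp
  ultimately have "c \<in> last_empty A n (t @ [x]) (n - card S) S"
    using c by (simp add: last_empty_def S_def)
  moreover have "card S \<le> n - x" using cardS xe by simp
  moreover have "S \<subseteq> A" by (auto simp: S_def)
  ultimately show ?thesis using that by blast
qed

text \<open>This makes the pieces of the partition disjoint. If \<open>U\<close> were smaller than
  \<open>V\<close>, the spot just behind \<open>n - card V\<close> would be at most
  \<open>n - card U\<close>; there the condition for \<open>U\<close> allows at most
  \<open>card V - 1\<close> cars in the tail, yet \<open>V\<close> is that tail. Equal sizes give
  equal thresholds and hence equal sets.\<close>

lemma last_empty_unique:
  assumes c: "c \<in> last_empty A n t (n - card S) S" "c \<in> last_empty A n t (n - card S') S'"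
    and S: "card S \<le> n" "card S' \<le> n"
  shows "S = S'"
proof -
  have *: "card U \<ge> card V"
    if U: "{i \<in> A. n - card U < c i} = U" and V: "{i \<in> A. n - card V < c i} = V"
      and b: "\<forall>s\<in>{1..n - card U}. card {i \<in> A. s \<le> c i} \<le> n - s"
      and Vn: "card V \<le> n" for U V
  proof (rule ccontr)
    assume "\<not> card V \<le> card U"
    moreover from this have "card {i \<in> A. Suc (n - card V) \<le> c i} \<le> n - Suc (n - card V)"
      using Vn by (intro b[rule_format]) auto
    ultimately show False using V Vn by (simp add: Suc_le_eq)
  qed
  have eqS: "{i \<in> A. n - card S < c i} = S" "{i \<in> A. n - card S' < c i} = S'"
    and bounds: "\<forall>s\<in>{1..n - card S}. card {i \<in> A. s \<le> c i} \<le> n - s"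
      "\<forall>s\<in>{1..n - card S'}. card {i \<in> A. s \<le> c i} \<le> n - s"
    using c unfolding last_empty_def by blast+
  have "card S = card S'"
    using *[OF eqS bounds(1) S(2)] *[OF eqS(2,1) bounds(2) S(1)] by (rule le_antisym[rotated])
  then show ?thesis using eqS by metis
qed

text \<open>The functions are classified by the set \<open>S\<close> of cars behind the last empty
  spot. That spot is \<open>n - card S\<close>, and it must not lie before \<open>x\<close>, whence
  the range of \<open>S\<close>.\<close>

lemma card_tail_bounded_snoc:
  assumes "finite A" and t: "taken_spots n (t @ [x])"
  shows "card (tail_bounded A n (t @ [x])) =
    (\<Sum>S | S \<subseteq> A \<and> card S \<le> n - x.
       card (tail_bounded S (card S) []) * card (tail_bounded (A - S) (n - card S - 1) t))"
proof -
  let ?I = "{S. S \<subseteq> A \<and> card S \<le> n - x}"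
  have Un: "tail_bounded A n (t @ [x]) = (\<Union>S\<in>?I. last_empty A n (t @ [x]) (n - card S) S)"
  proof (intro equalityI subsetI)
    fix c assume "c \<in> tail_bounded A n (t @ [x])"
    then obtain S where "S \<in> ?I" "c \<in> last_empty A n (t @ [x]) (n - card S) S"
      using tail_bounded_last_empty[OF t] by blast
    then show "c \<in> (\<Union>S\<in>?I. last_empty A n (t @ [x]) (n - card S) S)" by blast
  qed (simp add: last_empty_def)
  have fin: "\<forall>S\<in>?I. finite (last_empty A n (t @ [x]) (n - card S) S)"
    using finite_tail_bounded[OF assms(1)] by (simp add: last_empty_def)
  have disj: "\<forall>S\<in>?I. \<forall>S'\<in>?I. S \<noteq> S' \<longrightarrow>
      last_empty A n (t @ [x]) (n - card S) S \<inter> last_empty A n (t @ [x]) (n - card S') S' = {}"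
  proof (intro ballI impI equals0I)
    fix S S' c assume S: "S \<in> ?I" "S' \<in> ?I" "S \<noteq> S'"
      and c: "c \<in> last_empty A n (t @ [x]) (n - card S) S
        \<inter> last_empty A n (t @ [x]) (n - card S') S'"
    have "S = S'"
      by (rule last_empty_unique[of c A n "t @ [x]"]) (use S c in auto)
    then show False using S by simp
  qed
  have "finite ?I" using assms(1) by simp
  then have "card (tail_bounded A n (t @ [x])) =
      (\<Sum>S\<in>?I. card (last_empty A n (t @ [x]) (n - card S) S))"
    unfolding Un using fin disj by (rule card_UN_disjoint)
  also have "\<dots> = (\<Sum>S\<in>?I. card (tail_bounded S (card S) [] \<times> tail_bounded (A - S) (n - card S - 1) t))"
  proof (intro sum.cong refl bij_betw_same_card[symmetric])
    fix S assume "S \<in> ?I"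
    then show "bij_betw (\<lambda>(f, g). \<lambda>i\<in>A. if i \<in> S then f i + (n - card S) else g i)
           (tail_bounded S (card S) [] \<times> tail_bounded (A - S) (n - card S - 1) t)
           (last_empty A n (t @ [x]) (n - card S) S)"
      using t by (intro bij_betw_last_empty[OF assms(1)]) (auto simp: taken_spots_snoc)
  qed
  finally show ?thesis by (simp add: card_cartesian_product)
qed

section \<open>The index set and the counting formula\<close>

text \<open>The last entry \<open>k\<close> is the size of the last block. As the total is fixed,
  the lower bound that \<open>x\<close> puts on the sum of the other entries is the upper bound
  \<open>k \<le> n - x\<close>; the other conditions are those for \<open>t\<close>.\<close>

lemma L_snoc:
  assumes t: "taken_spots n (t @ [x])"
  shows "L n (t @ [x]) = (\<Union>k\<le>n - x. (\<lambda>l. l @ [k]) ` L (n - 1 - k) t)"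
proof (intro equalityI subsetI)
  have x: "1 \<le> x" "x \<le> n" "length t \<le> x - 1"
    using t by (auto simp: taken_spots_snoc dest: taken_spots_length)
  fix l assume l: "l \<in> L n (t @ [x])"
  then have "l \<noteq> []" by (auto simp: L_def)
  then obtain l' k where lk: "l = l' @ [k]" by (cases l rule: rev_exhaust) auto
  have len: "length l' = length t + 1" and sum: "sum_list l' + k = n - Suc (length t)"
    and b: "\<And>j. 1 \<le> j \<Longrightarrow> j \<le> Suc (length t) \<Longrightarrow>
        int (sum_list (take j l)) \<ge> int ((t @ [x]) ! (j - 1)) - int j"
    using l by (auto simp: L_def lk)
  have "int (sum_list l') \<ge> int x - int (length t + 1)"
    using b[of "Suc (length t)"] len by (simp add: lk nth_append)
  then have "k \<le> n - x" using sum x by linarith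
  moreover have "int (sum_list (take j l')) \<ge> int (t ! (j - 1)) - int j"
    if "j \<in> {1..length t}" for j
  proof -
    have "j - 1 < length t" "j \<le> length l'" using that len by auto
    then show ?thesis using b[of j] that by (simp add: lk nth_append)
  qed
  ultimately have "l' \<in> L (n - 1 - k) t" "k \<le> n - x"
    using len sum by (auto simp: L_def)
  then show "l \<in> (\<Union>k\<le>n - x. (\<lambda>l. l @ [k]) ` L (n - 1 - k) t)" using lk by auto
next
  \<comment> \<open>These facts, with \<open>k \<le> n - x\<close>, keep the natural-number
    differences below from truncating.\<close>
  have x: "1 \<le> x" "x \<le> n" "length t \<le> x - 1"
    using t by (auto simp: taken_spots_snoc dest: taken_spots_length)
  fix l assume "l \<in> (\<Union>k\<le>n - x. (\<lambda>l. l @ [k]) ` L (n - 1 - k) t)"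
  then obtain k l' where k: "k \<le> n - x" and lk: "l = l' @ [k]" and l': "l' \<in> L (n - 1 - k) t"
    by auto
  have len: "length l' = length t + 1" and sum: "sum_list l' = n - 1 - k - length t"
    and b: "\<And>j. 1 \<le> j \<Longrightarrow> j \<le> length t \<Longrightarrow>
        int (sum_list (take j l')) \<ge> int (t ! (j - 1)) - int j"
    using l' by (auto simp: L_def)
  have "int (sum_list (take j l)) \<ge> int ((t @ [x]) ! (j - 1)) - int j"
    if j: "j \<in> {1..length (t @ [x])}" for j
  proof (cases "j = length t + 1")
    case True
    then show ?thesis using len sum k x by (simp add: lk nth_append)
  next
    case False
    then have "j - 1 < length t" "j \<le> length l'" using j len by auto
    then show ?thesis using b[of j] j by (simp add: lk nth_append)
  qed
  then show "l \<in> L n (t @ [x])" using len sum k x unfolding L_def by (auto simp: lk)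
qed

lemma finite_L: "finite (L n t)"
proof (rule finite_subset)
  show "L n t \<subseteq> {l. set l \<subseteq> {..n} \<and> length l = length t + 1}"
    using member_le_sum_list by (fastforce simp: L_def)
  show "finite {l::nat list. set l \<subseteq> {..n} \<and> length l = length t + 1}"
    by (rule finite_lists_length_eq) simp
qed

lemma multinomial_snoc:
  "k \<le> N \<Longrightarrow> multinomial N (l @ [k]) = real (N choose k) * multinomial (N - k) l"
  by (simp add: multinomial_def binomial_fact field_simps)

text \<open>Both sides satisfy the same recursion in the last block: choose its \<open>k\<close>
  cars, count the parking functions on them, and treat the remaining cars with \<open>t\<close>. On
  the right, \<open>L_snoc\<close> splits the index set and \<open>multinomial_snoc\<close> the
  coefficient. Without taken spots there is one block.\<close>

lemma card_tail_bounded: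
  assumes "taken_spots n t" "finite A" "card A = n - length t"
  shows "real (card (tail_bounded A n t)) =
    (\<Sum>l \<in> L n t. multinomial (n - length t) l * (\<Prod>k\<leftarrow>l. (real k + 1) powi (int k - 1)))"
  using assms
proof (induction t arbitrary: n A rule: rev_induct)
  case Nil
  have "L n [] = {[n]}"
    by (auto simp: L_def length_Suc_conv)
  then show ?case
    using Nil card_parking_functions[of A n] by (simp add: multinomial_def)
next
  case (snoc x t)
  let ?w = "\<lambda>l. \<Prod>k\<leftarrow>l. (real k + 1) powi (int k - 1)"
  let ?R = "\<lambda>n t. \<Sum>l \<in> L n t. multinomial (n - length t) l * ?w l"
  let ?N = "n - length (t @ [x])"
  have x: "1 \<le> x" "x \<le> n" "length t \<le> x - 1" and tx: "taken_spots (x - 1) t"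
    using snoc.prems(1) by (auto simp: taken_spots_snoc dest: taken_spots_length)
  have A: "card A + length t + 1 = n" using snoc.prems(3) x by simp
  have "real (card (tail_bounded A n (t @ [x]))) =
    (\<Sum>S | S \<subseteq> A \<and> card S \<le> n - x. real (card (tail_bounded S (card S) [])) *
       real (card (tail_bounded (A - S) (n - card S - 1) t)))"
    using card_tail_bounded_snoc[OF snoc.prems(2,1)] by simp
  also have "\<dots> = (\<Sum>S | S \<subseteq> A \<and> card S \<le> n - x.
      (real (card S) + 1) powi (int (card S) - 1) * ?R (n - card S - 1) t)"
  proof (rule sum.cong[OF refl])
    fix S assume S: "S \<in> {S. S \<subseteq> A \<and> card S \<le> n - x}"
    then have fin: "finite S" using snoc.prems(2) finite_subset by blast
    have "taken_spots (n - card S - 1) t"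
      using taken_spots_mono[OF tx] S x by auto
    moreover have "card (A - S) = n - card S - 1 - length t"
      using A S fin by (auto simp: card_Diff_subset)
    ultimately have "real (card (tail_bounded (A - S) (n - card S - 1) t)) = ?R (n - card S - 1) t"
      using snoc.prems(2) by (intro snoc.IH) auto
    then show "real (card (tail_bounded S (card S) [])) *
        real (card (tail_bounded (A - S) (n - card S - 1) t)) =
        (real (card S) + 1) powi (int (card S) - 1) * ?R (n - card S - 1) t"
      using card_parking_functions[OF fin refl] by simp
  qed
  also have "\<dots> = (\<Sum>k\<le>n - x. of_nat (card A choose k) *
      ((real k + 1) powi (int k - 1) * ?R (n - k - 1) t))"
    by (rule sum_subsets_by_card[OF snoc.prems(2),
        where h = "\<lambda>k. (real k + 1) powi (int k - 1) * ?R (n - k - 1) t"])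
  also have "\<dots> = (\<Sum>k\<le>n - x. \<Sum>l\<in>(\<lambda>l. l @ [k]) ` L (n - 1 - k) t. multinomial ?N l * ?w l)"
  proof (rule sum.cong[OF refl])
    fix k assume k: "k \<in> {..n - x}"
    have "(\<Sum>l\<in>(\<lambda>l. l @ [k]) ` L (n - 1 - k) t. multinomial ?N l * ?w l)
        = (\<Sum>l\<in>L (n - 1 - k) t. multinomial ?N (l @ [k]) * ?w (l @ [k]))"
      by (subst sum.reindex) (auto simp: inj_on_def)
    also have "\<dots> = (\<Sum>l\<in>L (n - 1 - k) t. real (card A choose k) *
        ((real k + 1) powi (int k - 1) * (multinomial (n - k - 1 - length t) l * ?w l)))"
    proof (rule sum.cong[OF refl])
      fix l
      have "k \<le> ?N" "?N = card A" "?N - k = n - k - 1 - length t" using k x A by auto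
      then show "multinomial ?N (l @ [k]) * ?w (l @ [k]) = real (card A choose k) *
        ((real k + 1) powi (int k - 1) * (multinomial (n - k - 1 - length t) l * ?w l))"
        by (simp add: multinomial_snoc)
    qed
    finally show "of_nat (card A choose k) * ((real k + 1) powi (int k - 1) * ?R (n - k - 1) t) =
      (\<Sum>l\<in>(\<lambda>l. l @ [k]) ` L (n - 1 - k) t. multinomial ?N l * ?w l)"
      by (simp add: sum_distrib_left diff_right_commute)
  qed
  \<comment> \<open>Lists ending in different \<open>k\<close> differ, so the union is
    disjoint.\<close>
  also have "\<dots> = ?R n (t @ [x])"
    unfolding L_snoc[OF snoc.prems(1)]
    by (rule sum.UNION_disjoint[symmetric]) (auto simp: finite_L)
  finally show ?case .
qed

section \<open>From sorted lists to tail counts\<close>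

text \<open>If \<open>xs ! i > ys ! i\<close>, the threshold \<open>s = xs ! i\<close> is reached by
  at least \<open>N - i\<close> entries of \<open>xs\<close> but by at most \<open>N - i - 1\<close>
  of \<open>ys\<close>. This threshold is an entry of \<open>xs\<close>, so testing a set
  \<open>T\<close> that contains the entries suffices.\<close>

lemma sorted_pointwise_le_iff:
  fixes xs ys :: "'a::linorder list"
  assumes "sorted xs" "sorted ys" "length xs = N" "length ys = N" "set xs \<subseteq> T"
  shows "(\<forall>i<N. xs ! i \<le> ys ! i) \<longleftrightarrow>
    (\<forall>s\<in>T. length (filter (\<lambda>x. s \<le> x) xs) \<le> length (filter (\<lambda>x. s \<le> x) ys))"
proof (intro iffI ballI allI impI)
  fix s assume "\<forall>i<N. xs ! i \<le> ys ! i"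
  then have "{i. i < N \<and> s \<le> xs ! i} \<subseteq> {i. i < N \<and> s \<le> ys ! i}"
    by (auto intro: order_trans[of s "xs ! i" "ys ! i" for i])
  then have "card {i. i < N \<and> s \<le> xs ! i} \<le> card {i. i < N \<and> s \<le> ys ! i}"
    by (intro card_mono) auto
  then show "length (filter (\<lambda>x. s \<le> x) xs) \<le> length (filter (\<lambda>x. s \<le> x) ys)"
    using assms by (simp add: length_filter_conv_card)
next
  fix i assume le: "\<forall>s\<in>T. length (filter (\<lambda>x. s \<le> x) xs) \<le> length (filter (\<lambda>x. s \<le> x) ys)"
    and i: "i < N"
  show "xs ! i \<le> ys ! i"
  proof (rule ccontr)
    assume lt: "\<not> xs ! i \<le> ys ! i"
    have "{i..<N} \<subseteq> {j. j < N \<and> xs ! i \<le> xs ! j}"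
      using assms by (auto intro: sorted_nth_mono)
    then have "card {i..<N} \<le> card {j. j < N \<and> xs ! i \<le> xs ! j}"
      by (intro card_mono) auto
    moreover have "{j. j < N \<and> xs ! i \<le> ys ! j} \<subseteq> {Suc i..<N}"
    proof
      fix j assume j: "j \<in> {j. j < N \<and> xs ! i \<le> ys ! j}"
      have "\<not> j \<le> i"
        using sorted_nth_mono[OF assms(2), of j i] i assms(4) j lt by force
      then show "j \<in> {Suc i..<N}" using j by auto
    qed
    then have "card {j. j < N \<and> xs ! i \<le> ys ! j} \<le> card {Suc i..<N}"
      by (intro card_mono) auto
    moreover have "length (filter (\<lambda>x. xs ! i \<le> x) xs) \<le> length (filter (\<lambda>x. xs ! i \<le> x) ys)"
      using nth_mem[of i xs] i assms(3,5) by (intro le[rule_format]) auto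
    ultimately show False
      using i assms(3,4) by (simp add: length_filter_conv_card)
  qed
qed

text \<open>Free and taken spots partition \<open>{s..n}\<close>. This trades the count of free
  spots for that of taken ones, the form used in \<open>tail_bounded\<close>.\<close>

lemma length_filter_free_spots:
  assumes "taken_spots n t" "1 \<le> s"
  shows "length (filter (\<lambda>x. s \<le> x) (free_spots n t)) + length (filter (\<lambda>x. s \<le> x) t) = n + 1 - s"
proof -
  have d: "distinct t" and sub: "set t \<subseteq> {1..n}"
    using assms(1) by (auto simp: taken_spots_def strict_sorted_iff)
  have free: "length (filter (\<lambda>x. s \<le> x) (free_spots n t)) = card {x \<in> {1..n} - set t. s \<le> x}"
    by (subst distinct_card[symmetric]) (auto simp: free_spots_def)
  have taken: "length (filter (\<lambda>x. s \<le> x) t) = card {x \<in> set t. s \<le> x}"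
    using d by (subst distinct_card[symmetric]) auto
  have "{x \<in> {1..n} - set t. s \<le> x} \<union> {x \<in> set t. s \<le> x} = {s..n}"
    using sub assms(2) by auto
  then have "card ({x \<in> {1..n} - set t. s \<le> x} \<union> {x \<in> set t. s \<le> x}) = n + 1 - s"
    by simp
  then show ?thesis
    unfolding free taken by (subst (asm) card_Un_disjoint) auto
qed

text \<open>Tail counts do not see the order of entries, so the comparison of \<open>sort c\<close>
  with the free spots becomes a condition on \<open>c\<close> itself.\<close>

lemma parking_completions_iff:
  assumes "taken_spots n t"
  shows "c \<in> parking_completions n t \<longleftrightarrow>
    length c = n - length t \<and> set c \<subseteq> {1..n} \<and>
    (\<forall>s\<in>{1..n}. length (filter (\<lambda>x. s \<le> x) c) + length (filter (\<lambda>x. s \<le> x) t) \<le> n + 1 - s)"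
proof (cases "length c = n - length t \<and> set c \<subseteq> {1..n}")
  case True
  let ?u = "free_spots n t"
  have "length ?u = n - length t"
    using assms by (simp add: free_spots_def taken_spots_def strict_sorted_iff
        card_Diff_subset distinct_card)
  then have "(\<forall>i<n - length t. sort c ! i \<le> ?u ! i) \<longleftrightarrow>
      (\<forall>s\<in>{1..n}. length (filter (\<lambda>x. s \<le> x) (sort c)) \<le> length (filter (\<lambda>x. s \<le> x) ?u))"
    using True by (intro sorted_pointwise_le_iff) (auto simp: free_spots_def)
  also have "\<dots> \<longleftrightarrow> (\<forall>s\<in>{1..n}. length (filter (\<lambda>x. s \<le> x) c) \<le> length (filter (\<lambda>x. s \<le> x) ?u))"
    by (simp add: filter_sort)
  also have "\<dots> \<longleftrightarrow> (\<forall>s\<in>{1..n}. length (filter (\<lambda>x. s \<le> x) c) + length (filter (\<lambda>x. s \<le> x) t) \<le> n + 1 - s)"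
  proof (rule ball_cong[OF refl])
    fix s assume "s \<in> {1..n}"
    then show "length (filter (\<lambda>x. s \<le> x) c) \<le> length (filter (\<lambda>x. s \<le> x) ?u) \<longleftrightarrow>
        length (filter (\<lambda>x. s \<le> x) c) + length (filter (\<lambda>x. s \<le> x) t) \<le> n + 1 - s"
      using length_filter_free_spots[OF assms, of s] by auto
  qed
  finally show ?thesis
    using True by (simp add: parking_completions_def increasing_parking_completion_def)
next
  case False
  then show ?thesis by (auto simp: parking_completions_def)
qed

theorem theorem1p1:
  fixes n :: nat and t :: "nat list"
  assumes "taken_spots n t"
  shows "real (card (parking_completions n t)) =
    (\<Sum>l \<in> L n t. multinomial (n - length t) l * (\<Prod>k\<leftarrow>l. (real k + 1) powi (int k - 1)))"
proof -
  let ?N = "n - length t"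
  have filter_conv: "length (filter P c) = card {i \<in> {..<length c}. P (c ! i)}" for P and c :: "nat list"
    by (simp add: length_filter_conv_card)
  \<comment> \<open>The cars are the list positions \<open>{..<?N}\<close>. Functions in
    \<open>tail_bounded\<close> are \<open>undefined\<close> elsewhere, so restricting
    \<open>nth\<close> inverts the passage to lists.\<close>
  have "bij_betw (\<lambda>f. map f [0..<?N]) (tail_bounded {..<?N} n t) (parking_completions n t)"
  proof (rule bij_betw_byWitness[where f' = "\<lambda>c. \<lambda>i\<in>{..<?N}. c ! i"])
    show "\<forall>f\<in>tail_bounded {..<?N} n t. (\<lambda>i\<in>{..<?N}. map f [0..<?N] ! i) = f"
    proof
      fix f assume "f \<in> tail_bounded {..<?N} n t"
      then have f: "f \<in> {..<?N} \<rightarrow>\<^sub>E {1..n}" by (simp add: tail_bounded_def)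
      show "(\<lambda>i\<in>{..<?N}. map f [0..<?N] ! i) = f"
      proof
        fix i show "(\<lambda>i\<in>{..<?N}. map f [0..<?N] ! i) i = f i"
          using PiE_arb[OF f, of i] by simp
      qed
    qed
    show "\<forall>c\<in>parking_completions n t. map (\<lambda>i\<in>{..<?N}. c ! i) [0..<?N] = c"
      by (auto simp: parking_completions_def intro: nth_equalityI)
    show "(\<lambda>f. map f [0..<?N]) ` tail_bounded {..<?N} n t \<subseteq> parking_completions n t"
    proof (rule image_subsetI)
      fix f assume f: "f \<in> tail_bounded {..<?N} n t"
      then have "f \<in> {..<?N} \<rightarrow>\<^sub>E {1..n}" by (simp add: tail_bounded_def)
      from PiE_mem[OF this] have "set (map f [0..<?N]) \<subseteq> {1..n}" by auto
      moreover have "length (filter (\<lambda>x. s \<le> x) (map f [0..<?N])) = card {i \<in> {..<?N}. s \<le> f i}" for s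
        unfolding filter_conv by (rule arg_cong[of _ _ card]) auto
      ultimately show "map f [0..<?N] \<in> parking_completions n t"
        using f unfolding parking_completions_iff[OF assms] by (simp add: tail_bounded_def)
    qed
    show "(\<lambda>c. \<lambda>i\<in>{..<?N}. c ! i) ` parking_completions n t \<subseteq> tail_bounded {..<?N} n t"
    proof (rule image_subsetI)
      fix c assume c: "c \<in> parking_completions n t"
      then have len: "length c = ?N" and sub: "set c \<subseteq> {1..n}"
        by (simp_all add: parking_completions_def)
      have "(\<lambda>i\<in>{..<?N}. c ! i) \<in> {..<?N} \<rightarrow>\<^sub>E {1..n}"
        unfolding restrict_PiE_iff
      proof
        fix i assume "i \<in> {..<?N}"
        then have "c ! i \<in> set c" using len by simp
        then show "c ! i \<in> {1..n}" using sub by blast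
      qed
      moreover have "card {i \<in> {..<?N}. s \<le> (\<lambda>i\<in>{..<?N}. c ! i) i} = length (filter (\<lambda>x. s \<le> x) c)" for s
        unfolding filter_conv len by (rule arg_cong[of _ _ card]) auto
      ultimately show "(\<lambda>i\<in>{..<?N}. c ! i) \<in> tail_bounded {..<?N} n t"
        using c unfolding parking_completions_iff[OF assms] by (simp add: tail_bounded_def)
    qed
  qed
  then have "card (parking_completions n t) = card (tail_bounded {..<?N} n t)"
    by (simp add: bij_betw_same_card)
  then show ?thesis using card_tail_bounded[OF assms, of "{..<?N}"] by simp
qed

end
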